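(* Let $K$ be a field and let $\Delta:K\{x\}\to K\{x\}\otimes K\{x\}$ be the unique $K$-algebra homomorphism (i.e. $K$-linear map with $\Delta(1)=1\otimes1$ compatible with all operations $\cdot_m$, $m\ge2$) such that $\Delta(x)=x\otimes 1+1\otimes x$. Then for every $T\in\mathbb{P}$, $$\Delta(x^T)=\sum_{S,V\in\mathbb{P}}\binom{T}{S,V}\,x^S\otimes x^V.$$
   Context: $\mathbb{P}$ is the set of isomorphism classes of finite planar reduced rooted trees: finite rooted trees in which the children of every vertex are linearly ordered and no vertex has exactly one child. The empty tree $\underline{1}$ is included in $\mathbb{P}$; $x$ also denotes the tree with a single vertex. $L(T)$ is the set of leaves (vertices without children) of $T$. For $m\ge 2$ and nonempty $T_1,\dots,T_m$, the $m$-ary grafting $\cdot_m(T_1,\dots,T_m)$ is the tree whose root has exactly $m$ children, which are, in order, the roots of $T_1,\dots,T_m$. Contraction: for $I\subseteq L(T)$, $T|I\in\mathbb{P}$ is $\underline{1}$ if $I=\emptyset$; otherwise keep exactly the vertices of $T$ on a path from the root to a leaf in $I$, with the inherited order, and suppress every vertex having exactly one child (if this is the root, delete it and let its child be the new root, repeatedly). Planar binomial coefficient of the second kind: for $T,S,V\in\mathbb{P}$, $\binom{T}{S,V}=\#\{I\subseteq L(T): T|I=S,\ T|(L(T)\setminus I)=V\}$ (equality in $\mathbb{P}$). $K\{x\}$ (planar polynomials) is the $K$-vector space with basis $\mathbb{P}$; the basis element of $S\in\mathbb{P}$ is written $x^S$ (or $S(x)$), with $x^{\underline{1}}=1$ and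 $x^x=x$. For each $m\ge2$ it carries the $K$-multilinear operation $\cdot_m$ extending $m$-ary grafting of trees, where empty trees among the arguments are omitted: if exactly $k$ of the $m$ trees are nonempty, the result is the $k$-ary grafting of these in order if $k\ge 2$, the single nonempty tree if $k=1$, and $\underline{1}$ if $k=0$. On $K\{x\}\otimes_K K\{x\}$ the operation $\cdot_m$ is the $K$-multilinear map with $\cdot_m(a_1\otimes b_1,\dots,a_m\otimes b_m)=\cdot_m(a_1,\dots,a_m)\otimes\cdot_m(b_1,\dots,b_m)$. *)

theory Defs
  imports "HOL.Vector_Spaces" "HOL-Library.Poly_Mapping"
begin

section \<open>Planar reduced rooted trees\<close>

text \<open>A term of type \<open>rtree\<close> is an isomorphism class of nonempty finite planar rooted trees.
  A vertex is given by its address: the list of child indices, counted from \<open>0\<close>, on the path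
  from the root to it.\<close>

datatype rtree = Node "rtree list"

fun reduced :: "rtree \<Rightarrow> bool" where
  "reduced (Node ts) \<longleftrightarrow> length ts \<noteq> 1 \<and> (\<forall>t\<in>set ts. reduced t)"

fun subtree_at :: "rtree \<Rightarrow> nat list \<Rightarrow> rtree option" where
  "subtree_at t [] = Some t"
| "subtree_at (Node ts) (i # p) = (if i < length ts then subtree_at (ts ! i) p else None)"

definition rleaves :: "rtree \<Rightarrow> nat list set" where
  "rleaves t = {p. subtree_at t p = Some (Node [])}"

text \<open>For a nonempty set \<open>I\<close> of leaves of \<open>t\<close>, \<open>prune t I\<close> consists of the vertices of \<open>t\<close> on a
  path from the root to a leaf in \<open>I\<close>: child number \<open>i\<close> of the root survives iff \<open>I\<close> contains an
  address starting with \<open>i\<close>.\<close>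

function prune :: "rtree \<Rightarrow> nat list set \<Rightarrow> rtree" where
  "prune (Node ts) I =
     Node (map (\<lambda>(i, t). prune t {p. i # p \<in> I})
            (filter (\<lambda>(i, t). \<exists>p. i # p \<in> I) (enumerate 0 ts)))"
  by pat_completeness auto
termination
proof (relation "measure (\<lambda>(t, I). size t)")
  fix ts :: "rtree list" and I :: "nat list set" and z i t
  assume "z \<in> set (filter (\<lambda>(i, t). \<exists>p. i # p \<in> I) (enumerate 0 ts))" "(i, t) = z"
  then have "t \<in> set ts" by (auto simp: in_set_enumerate_eq)
  then show "((t, {p. i # p \<in> I}), (Node ts, I)) \<in> measure (\<lambda>(t, I). size t)"
    by (simp add: size_list_estimation' less_Suc_eq_le)
qed simp

fun suppress :: "rtree \<Rightarrow> rtree" where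
  "suppress (Node ts) = (case map suppress ts of [t] \<Rightarrow> t | ts' \<Rightarrow> Node ts')"

lemma reduced_suppress: "reduced (suppress t)"
  by (induction t rule: suppress.induct) (auto split: list.split)

text \<open>The set of planar reduced trees; \<open>None\<close> is the empty tree.\<close>

typedef ptree = "{T :: rtree option. pred_option reduced T}"
  by (rule exI[of _ None]) simp

setup_lifting type_definition_ptree

lift_definition empty_tree :: ptree is None by simp

lift_definition dot_tree :: ptree is "Some (Node [])" by simp

lift_definition leaves :: "ptree \<Rightarrow> nat list set"
  is "\<lambda>T. case T of None \<Rightarrow> {} | Some t \<Rightarrow> rleaves t" .

lift_definition contraction :: "ptree \<Rightarrow> nat list set \<Rightarrow> ptree" (infixl \<open>\<downharpoonright>\<close> 75)
  is "\<lambda>T I. case T of None \<Rightarrow> None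
        | Some t \<Rightarrow> if I = {} then None else Some (suppress (prune t I))"
  by (auto simp: reduced_suppress split: option.split)

definition planar_binomial :: "ptree \<Rightarrow> ptree \<Rightarrow> ptree \<Rightarrow> nat" where
  "planar_binomial T S V = card {I. I \<subseteq> leaves T \<and> T \<downharpoonright> I = S \<and> T \<downharpoonright> (leaves T - I) = V}"

text \<open>Grafting, with empty trees among the arguments omitted.\<close>

lift_definition graft :: "ptree list \<Rightarrow> ptree"
  is "\<lambda>Ts. case List.map_filter id Ts of [] \<Rightarrow> None | [t] \<Rightarrow> Some t | ts \<Rightarrow> Some (Node ts)"
proof -
  fix Ts :: "rtree option list"
  assume *: "list_all (pred_option reduced) Ts"
  have "\<forall>t\<in>set (List.map_filter id Ts). reduced t"
    using * by (auto simp: map_filter_def list_all_iff dest!: bspec)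
  then show "pred_option reduced
      (case List.map_filter id Ts of [] \<Rightarrow> None | [t] \<Rightarrow> Some t | ts \<Rightarrow> Some (Node ts))"
    by (auto split: list.split)
qed

section \<open>Planar polynomials\<close>

text \<open>A \<open>K\<close>-vector space with basis \<open>B\<close> is modelled by the type \<open>B \<Rightarrow>\<^sub>0 K\<close> of finitely supported
  functions, with the following scalar multiplication.\<close>

definition scale :: "'k \<Rightarrow> ('b \<Rightarrow>\<^sub>0 'k) \<Rightarrow> ('b \<Rightarrow>\<^sub>0 'k::field)" (infixr \<open>*\<^sub>s\<close> 75) where
  "c *\<^sub>s p = Poly_Mapping.map ((*) c) p"

definition mon :: "'b \<Rightarrow> ('b \<Rightarrow>\<^sub>0 'k::field)" where
  "mon b = Poly_Mapping.single b 1"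

type_synonym 'k planar_poly = "ptree \<Rightarrow>\<^sub>0 'k"

text \<open>The tensor square of planar polynomials is the vector space with basis the pairs of trees;
  the universal property is \<open>tensor_universal\<close> below.\<close>

type_synonym 'k planar_poly2 = "ptree \<times> ptree \<Rightarrow>\<^sub>0 'k"

definition tensor :: "('a \<Rightarrow>\<^sub>0 'k) \<Rightarrow> ('b \<Rightarrow>\<^sub>0 'k) \<Rightarrow> ('a \<times> 'b \<Rightarrow>\<^sub>0 'k::field)" (infixl \<open>\<otimes>\<close> 76) where
  "p \<otimes> q = (\<Sum>S\<in>Poly_Mapping.keys p. \<Sum>V\<in>Poly_Mapping.keys q. (Poly_Mapping.lookup p S * Poly_Mapping.lookup q V) *\<^sub>s mon (S, V))"

text \<open>The multilinear extension of a map \<open>F\<close> given on tuples (lists) of basis elements.\<close>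

definition multilinear_ext ::
    "('b list \<Rightarrow> ('c \<Rightarrow>\<^sub>0 'k)) \<Rightarrow> ('b \<Rightarrow>\<^sub>0 'k) list \<Rightarrow> ('c \<Rightarrow>\<^sub>0 'k::field)" where
  "multilinear_ext F ps =
     (\<Sum>bs\<in>listset (map Poly_Mapping.keys ps). prod_list (map2 Poly_Mapping.lookup ps bs) *\<^sub>s F bs)"

text \<open>The operation \<open>\<cdot>\<^sub>m\<close> is the restriction of the following maps to lists of length \<open>m\<close>.\<close>

definition planar_op :: "'k planar_poly list \<Rightarrow> 'k::field planar_poly" where
  "planar_op = multilinear_ext (\<lambda>Ts. mon (graft Ts))"

definition planar_op2 :: "'k planar_poly2 list \<Rightarrow> 'k::field planar_poly2" where
  "planar_op2 = multilinear_ext (\<lambda>Ps. mon (graft (map fst Ps)) \<otimes> mon (graft (map snd Ps)))"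

definition planar_algebra_hom :: "('k::field planar_poly \<Rightarrow> 'k planar_poly2) \<Rightarrow> bool" where
  "planar_algebra_hom \<Delta> \<longleftrightarrow>
     Vector_Spaces.linear scale scale \<Delta> \<and>
     \<Delta> (mon empty_tree) = mon empty_tree \<otimes> mon empty_tree \<and>
     (\<forall>ps. length ps \<ge> 2 \<longrightarrow> \<Delta> (planar_op ps) = planar_op2 (map \<Delta> ps))"

section \<open>Adequacy of the definitions\<close>

subsection \<open>Linear extension\<close>

lemma lookup_scale [simp]: "Poly_Mapping.lookup (c *\<^sub>s p) b = c * Poly_Mapping.lookup p b"
  by (simp add: scale_def Poly_Mapping.map.rep_eq when_def)

lemma lookup_mon: "Poly_Mapping.lookup (mon b) c = (if b = c then 1 else 0)"
  by (simp add: mon_def lookup_single when_def)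

lemma keys_mon [simp]: "Poly_Mapping.keys (mon b :: 'b \<Rightarrow>\<^sub>0 'k::field) = {b}"
  by (simp add: mon_def)

lemma vector_space_scale: "vector_space (scale :: 'k::field \<Rightarrow> ('b \<Rightarrow>\<^sub>0 'k) \<Rightarrow> _)"
  by unfold_locales (auto intro!: poly_mapping_eqI simp: lookup_add algebra_simps)

interpretation scale: vector_space "scale :: 'k::field \<Rightarrow> ('b \<Rightarrow>\<^sub>0 'k) \<Rightarrow> _"
  by (rule vector_space_scale)

lemma linear_scale_iff:
  "Vector_Spaces.linear scale scale f \<longleftrightarrow>
     (\<forall>p q. f (p + q) = f p + f q) \<and> (\<forall>c p. f (c *\<^sub>s p) = c *\<^sub>s f p)"
  by (auto simp: Vector_Spaces.linear_iff vector_space_scale)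

definition linear_ext :: "('b \<Rightarrow> ('c \<Rightarrow>\<^sub>0 'k)) \<Rightarrow> ('b \<Rightarrow>\<^sub>0 'k) \<Rightarrow> ('c \<Rightarrow>\<^sub>0 'k::field)" where
  "linear_ext h p = (\<Sum>b\<in>Poly_Mapping.keys p. Poly_Mapping.lookup p b *\<^sub>s h b)"

lemma linear_ext_superset:
  assumes "finite A" "Poly_Mapping.keys p \<subseteq> A"
  shows "linear_ext h p = (\<Sum>b\<in>A. Poly_Mapping.lookup p b *\<^sub>s h b)"
  unfolding linear_ext_def
  by (rule sum.mono_neutral_left) (use assms in \<open>auto simp: in_keys_iff\<close>)

lemma linear_ext_add: "linear_ext h (p + q) = linear_ext h p + linear_ext h q"
proof -
  have A: "finite (Poly_Mapping.keys p \<union> Poly_Mapping.keys q)" by simp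
  show ?thesis
    using keys_add[of p q]
    by (simp add: linear_ext_superset[OF A] lookup_add scale.scale_left_distrib sum.distrib)
qed

lemma linear_ext_scale: "linear_ext h (c *\<^sub>s p) = c *\<^sub>s linear_ext h p"
proof -
  have "Poly_Mapping.keys (c *\<^sub>s p) \<subseteq> Poly_Mapping.keys p" by (auto simp: in_keys_iff)
  then show ?thesis
    by (simp add: linear_ext_superset[of "Poly_Mapping.keys p"] scale.scale_sum_right)
qed

lemma linear_linear_ext: "Vector_Spaces.linear scale scale (linear_ext h)"
  by (simp add: linear_scale_iff linear_ext_add linear_ext_scale)

lemma linear_ext_zero [simp]: "linear_ext h 0 = 0"
  by (simp add: linear_ext_def)

lemma linear_ext_sum: "linear_ext h (\<Sum>i\<in>A. f i) = (\<Sum>i\<in>A. linear_ext h (f i))"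
  by (induction A rule: infinite_finite_induct) (auto simp: linear_ext_add)

lemma linear_ext_mon [simp]: "linear_ext h (mon b) = h b"
  by (simp add: linear_ext_def lookup_mon)

lemma linear_ext_id [simp]: "linear_ext mon p = p"
proof (rule poly_mapping_eqI)
  fix b
  have "Poly_Mapping.lookup (linear_ext mon p) b = (\<Sum>c\<in>Poly_Mapping.keys p. if c = b then Poly_Mapping.lookup p c else 0)"
    unfolding linear_ext_def lookup_sum by (intro sum.cong) (auto simp: lookup_mon)
  also have "\<dots> = Poly_Mapping.lookup p b" by (simp add: in_keys_iff)
  finally show "Poly_Mapping.lookup (linear_ext mon p) b = Poly_Mapping.lookup p b" .
qed

lemma linear_ext_linear_ext: "linear_ext h (linear_ext g p) = linear_ext (\<lambda>c. linear_ext h (g c)) p"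
  by (simp add: linear_ext_def[of g] linear_ext_def[of "\<lambda>c. linear_ext h (g c)"]
      linear_ext_sum linear_ext_scale)

lemma linear_eq_linear_ext:
  assumes "vector_space s" and f: "Vector_Spaces.linear scale s f"
  shows "f p = (\<Sum>b\<in>Poly_Mapping.keys p. s (Poly_Mapping.lookup p b) (f (mon b)))"
proof -
  interpret f: Vector_Spaces.linear scale s f by (rule f)
  have "f p = f (linear_ext mon p)" by simp
  also have "\<dots> = (\<Sum>b\<in>Poly_Mapping.keys p. s (Poly_Mapping.lookup p b) (f (mon b)))"
    by (simp add: linear_ext_def f.sum f.scale del: linear_ext_id)
  finally show ?thesis .
qed

subsection \<open>Tensor products\<close>

lemma tensor_eq_linear_ext: "p \<otimes> q = linear_ext (\<lambda>S. linear_ext (\<lambda>V. mon (S, V)) q) p"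
  by (simp add: tensor_def linear_ext_def scale.scale_sum_right)

lemma tensor_mon [simp]: "mon S \<otimes> mon V = mon (S, V)"
  by (simp add: tensor_eq_linear_ext)

lemma linear_ext_fun_linear:
  assumes "\<And>b. Vector_Spaces.linear scale scale (\<lambda>q. h q b)"
  shows "Vector_Spaces.linear scale scale (\<lambda>q. linear_ext (h q) p)"
  using assms unfolding linear_scale_iff linear_ext_def
  by (simp add: scale.scale_right_distrib sum.distrib scale.scale_sum_right mult.commute)

lemma linear_tensor_left: "Vector_Spaces.linear scale scale (\<lambda>p. p \<otimes> q)"
  unfolding tensor_eq_linear_ext by (rule linear_linear_ext)

lemma linear_tensor_right: "Vector_Spaces.linear scale scale (\<lambda>q. p \<otimes> q)"
  unfolding tensor_eq_linear_ext by (intro linear_ext_fun_linear linear_linear_ext)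

theorem tensor_universal:
  fixes s :: "'k::field \<Rightarrow> 'v::ab_group_add \<Rightarrow> 'v"
    and B :: "('a \<Rightarrow>\<^sub>0 'k) \<Rightarrow> ('b \<Rightarrow>\<^sub>0 'k) \<Rightarrow> 'v"
  assumes s: "vector_space s"
    and left: "\<And>q. Vector_Spaces.linear scale s (\<lambda>p. B p q)"
    and right: "\<And>p. Vector_Spaces.linear scale s (\<lambda>q. B p q)"
  shows "\<exists>!f. Vector_Spaces.linear scale s f \<and> (\<forall>p q. f (p \<otimes> q) = B p q)"
proof (rule ex1I)
  interpret s: vector_space s by (rule s)
  define f where
    "f r = (\<Sum>b\<in>Poly_Mapping.keys r. s (Poly_Mapping.lookup r b) (B (mon (fst b)) (mon (snd b))))" for r
  have sup: "f r = (\<Sum>b\<in>A. s (Poly_Mapping.lookup r b) (B (mon (fst b)) (mon (snd b))))"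
    if "finite A" "Poly_Mapping.keys r \<subseteq> A" for r A
    unfolding f_def by (rule sum.mono_neutral_left) (use that in \<open>auto simp: in_keys_iff\<close>)
  have lin: "Vector_Spaces.linear scale s f"
    unfolding Vector_Spaces.linear_iff
  proof (intro conjI allI)
    show "f (p + q) = f p + f q" for p q
      using keys_add[of p q]
      by (simp add: sup[of "Poly_Mapping.keys p \<union> Poly_Mapping.keys q"] lookup_add s.scale_left_distrib sum.distrib)
    show "f (c *\<^sub>s p) = s c (f p)" for c p
    proof -
      have "Poly_Mapping.keys (c *\<^sub>s p) \<subseteq> Poly_Mapping.keys p" by (auto simp: in_keys_iff)
      then show ?thesis by (simp add: sup[of "Poly_Mapping.keys p"] s.scale_sum_right)
    qed
  qed (use s vector_space_scale in auto)
  have mon: "f (mon b) = B (mon (fst b)) (mon (snd b))" for b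
    by (simp add: f_def lookup_mon)
  show "Vector_Spaces.linear scale s f \<and> (\<forall>p q. f (p \<otimes> q) = B p q)"
  proof (intro conjI allI lin)
    fix p q
    interpret f: Vector_Spaces.linear scale s f by (rule lin)
    show "f (p \<otimes> q) = B p q"
      unfolding tensor_def linear_eq_linear_ext[OF s left, of p]
      unfolding linear_eq_linear_ext[OF s right, of _ q]
      by (simp add: f.sum f.scale mon s.scale_sum_right)
  qed
  fix g assume g: "Vector_Spaces.linear scale s g \<and> (\<forall>p q. g (p \<otimes> q) = B p q)"
  have eq: "g (mon b) = f (mon b)" for b
    using g[THEN conjunct2, rule_format, of "mon (fst b)" "mon (snd b)"] mon by simp
  show "g = f"
  proof
    show "g r = f r" for r
      unfolding linear_eq_linear_ext[OF s lin, of r]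
        linear_eq_linear_ext[OF s g[THEN conjunct1], of r] eq ..
  qed
qed

subsection \<open>Multilinear extension\<close>

lemma multilinear_ext_Nil [simp]: "multilinear_ext F [] = F []"
  by (simp add: multilinear_ext_def)

lemma multilinear_ext_Cons [simp]:
  "multilinear_ext F (p # ps) = linear_ext (\<lambda>b. multilinear_ext (\<lambda>bs. F (b # bs)) ps) p"
proof -
  have "listset (map Poly_Mapping.keys (p # ps)) = (\<lambda>(b, bs). b # bs) ` (Poly_Mapping.keys p \<times> listset (map Poly_Mapping.keys ps))"
    by (auto simp: set_Cons_def)
  moreover have "inj_on (\<lambda>(b, bs). b # bs) (Poly_Mapping.keys p \<times> listset (map Poly_Mapping.keys ps))"
    by (auto simp: inj_on_def)
  ultimately show ?thesis
    by (simp add: multilinear_ext_def linear_ext_def sum.reindex scale.scale_sum_right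
        sum.cartesian_product case_prod_unfold)
qed

lemma multilinear_ext_mon: "multilinear_ext F (map mon bs) = F bs"
  by (induction bs arbitrary: F) auto

lemma linear_multilinear_ext:
  "i < length ps \<Longrightarrow> Vector_Spaces.linear scale scale (\<lambda>p. multilinear_ext F (ps[i := p]))"
proof (induction ps arbitrary: i F)
  case (Cons q ps)
  then show ?case
    by (cases i) (auto intro: linear_linear_ext linear_ext_fun_linear)
qed simp

lemma linear_ext_swap:
  "linear_ext (\<lambda>a. linear_ext (\<lambda>b. G a b) q) p = linear_ext (\<lambda>b. linear_ext (\<lambda>a. G a b) p) q"
  unfolding linear_ext_def
  by (simp add: scale.scale_sum_right mult.commute) (rule sum.swap)

lemma linear_ext_multilinear_ext:
  "linear_ext h (multilinear_ext F ps) = multilinear_ext (\<lambda>bs. linear_ext h (F bs)) ps"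
  by (induction ps arbitrary: F) (auto simp: linear_ext_linear_ext)

lemma linear_ext_multilinear_ext_swap:
  "linear_ext (\<lambda>b. multilinear_ext (G b) ps) p = multilinear_ext (\<lambda>bs. linear_ext (\<lambda>b. G b bs) p) ps"
proof (induction ps arbitrary: G)
  case (Cons q ps)
  show ?case
    by (simp add: Cons.IH[symmetric]) (rule linear_ext_swap)
qed simp

lemma multilinear_ext_map_linear_ext:
  "multilinear_ext F (map (linear_ext g) ps) = multilinear_ext (\<lambda>bs. multilinear_ext F (map g bs)) ps"
  by (induction ps arbitrary: F)
    (simp_all add: linear_ext_linear_ext linear_ext_multilinear_ext_swap)

lemma linear_ext_tensor:
  "linear_ext (\<lambda>(S, V). G S \<otimes> H V) (p \<otimes> q) = linear_ext G p \<otimes> linear_ext H q"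
proof -
  have "linear_ext G p \<otimes> linear_ext H q =
      linear_ext (\<lambda>S. linear_ext (\<lambda>T. linear_ext (\<lambda>V. mon (T, V)) (linear_ext H q)) (G S)) p"
    by (simp add: tensor_eq_linear_ext linear_ext_linear_ext)
  also have "\<dots> = linear_ext (\<lambda>S. linear_ext (\<lambda>V. G S \<otimes> H V) q) p"
    by (simp add: tensor_eq_linear_ext linear_ext_linear_ext)
       (subst linear_ext_swap, rule refl)
  finally show ?thesis
    by (simp add: tensor_eq_linear_ext[of p] linear_ext_linear_ext)
qed

lemma multilinear_ext_tensor:
  "length ps = length qs \<Longrightarrow>
   multilinear_ext (\<lambda>Ps. G (map fst Ps) \<otimes> H (map snd Ps)) (map2 tensor ps qs) =
     multilinear_ext G ps \<otimes> multilinear_ext H qs"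
proof (induction ps qs arbitrary: G H rule: list_induct2)
  case (Cons p ps q qs)
  show ?case
    using Cons.IH[of "\<lambda>bs. G (_ # bs)" "\<lambda>bs. H (_ # bs)"]
    by (simp add: linear_ext_tensor[symmetric] case_prod_unfold)
qed simp

theorem planar_op2_tensor:
  "length ps = length qs \<Longrightarrow> planar_op2 (map2 tensor ps qs) = planar_op ps \<otimes> planar_op qs"
  unfolding planar_op2_def planar_op_def by (rule multilinear_ext_tensor)

theorem linear_planar_op:
  "i < length ps \<Longrightarrow> Vector_Spaces.linear scale scale (\<lambda>p. planar_op (ps[i := p]))"
  unfolding planar_op_def by (rule linear_multilinear_ext)

theorem linear_planar_op2:
  "i < length ps \<Longrightarrow> Vector_Spaces.linear scale scale (\<lambda>p. planar_op2 (ps[i := p]))"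
  unfolding planar_op2_def by (rule linear_multilinear_ext)

theorem planar_op_mon: "planar_op (map mon Ts) = mon (graft Ts)"
  unfolding planar_op_def by (rule multilinear_ext_mon)

subsection \<open>The binomial sum is finite\<close>

text \<open>\<open>Sum_any\<close> over all pairs of trees is meaningful only for finitely supported summands.\<close>

lemma finite_rleaves: "finite (rleaves t)"
proof (induction t)
  case (Node ts)
  have "rleaves (Node ts) \<subseteq> insert [] (\<Union>i\<in>{..<length ts}. (#) i ` rleaves (ts ! i))"
  proof
    fix p assume "p \<in> rleaves (Node ts)"
    then show "p \<in> insert [] (\<Union>i\<in>{..<length ts}. (#) i ` rleaves (ts ! i))"
      by (cases p) (auto simp: rleaves_def split: if_splits)
  qed
  then show ?case by (rule finite_subset) (use Node in auto)
qed

lemma finite_leaves: "finite (leaves T)"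
  by transfer (auto simp: finite_rleaves split: option.split)

theorem finite_planar_binomial: "finite {(S, V). planar_binomial T S V \<noteq> 0}"
proof (rule finite_subset)
  show "{(S, V). planar_binomial T S V \<noteq> 0} \<subseteq>
      (\<lambda>I. (T \<downharpoonright> I, T \<downharpoonright> (leaves T - I))) ` Pow (leaves T)"
    by (auto simp: planar_binomial_def card_eq_0_iff)
qed (simp add: finite_leaves)

subsection \<open>Existence and uniqueness of the homomorphism\<close>

lemma graft_omit: "graft (Ts @ empty_tree # Us) = graft (Ts @ Us)"
  by transfer (simp add: map_filter_def)

lemma graft_Nil: "graft [] = empty_tree"
  by transfer (simp add: map_filter_def)

lemma graft_singleton: "graft [T] = T"
  by transfer (auto simp: map_filter_def split: option.split)

lemma Rep_graft:
  assumes "length Ts \<ge> 2" "empty_tree \<notin> set Ts"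
  shows "Rep_ptree (graft Ts) = Some (Node (map (the \<circ> Rep_ptree) Ts))"
proof -
  have "List.map_filter id (map Rep_ptree Ts) = map (the \<circ> Rep_ptree) Ts"
    using assms(2)
    by (induction Ts)
      (auto simp: map_filter_def empty_tree.rep_eq[symmetric] Rep_ptree_inject)
  then show ?thesis
    using assms(1) by (auto simp: graft.rep_eq split: list.split)
qed

fun rcoadd :: "rtree \<Rightarrow> 'k::field planar_poly2" where
  "rcoadd (Node ts) =
     (if ts = [] then mon dot_tree \<otimes> mon empty_tree + mon empty_tree \<otimes> mon dot_tree
      else planar_op2 (map rcoadd ts))"

definition coadd :: "ptree \<Rightarrow> 'k::field planar_poly2" where
  "coadd T = (case Rep_ptree T of None \<Rightarrow> mon (empty_tree, empty_tree) | Some t \<Rightarrow> rcoadd t)"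

lemma coadd_empty [simp]: "coadd empty_tree = mon (empty_tree, empty_tree)"
  by (simp add: coadd_def empty_tree.rep_eq)

lemma multilinear_ext_omit:
  assumes "\<And>xs ys. F (xs @ e # ys) = F (xs @ ys)" and "g e0 = mon e"
  shows "multilinear_ext F (map g bs) = multilinear_ext F (map g (filter (\<lambda>b. b \<noteq> e0) bs))"
  using assms(1)
proof (induction bs arbitrary: F)
  case (Cons b bs)
  have IH: "multilinear_ext (\<lambda>bs. F (c # bs)) (map g bs) =
      multilinear_ext (\<lambda>bs. F (c # bs)) (map g (filter (\<lambda>b. b \<noteq> e0) bs))" for c
    by (rule Cons.IH) (use Cons.prems[of "c # _"] in simp)
  have "F (e # bs) = F bs" for bs
    using Cons.prems[of "[]"] by simp
  then show ?case
    using IH Cons.IH[OF Cons.prems] assms(2) by auto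
qed simp

lemma planar_op2_coadd:
  "planar_op2 (map coadd Ts) = (coadd (graft Ts) :: 'k::field planar_poly2)"
proof -
  let ?Us = "filter (\<lambda>T. T \<noteq> empty_tree) Ts"
  have "graft Ts = graft ?Us"
    by transfer (simp add: map_filter_def filter_filter split: list.split)
  moreover have "planar_op2 (map coadd Ts) = (planar_op2 (map coadd ?Us) :: 'k planar_poly2)"
    unfolding planar_op2_def
    by (rule multilinear_ext_omit[where e = "(empty_tree, empty_tree)"]) (simp_all add: graft_omit)
  moreover have "planar_op2 (map coadd ?Us) = (coadd (graft ?Us) :: 'k planar_poly2)"
  proof -
    consider "?Us = []" | U where "?Us = [U]" | "length ?Us \<ge> 2"
      by (cases ?Us rule: remdups_adj.cases) auto
    then show ?thesis
    proof cases
      case 1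
      show ?thesis unfolding 1 by (simp add: planar_op2_def graft_Nil)
    next
      case 2
      show ?thesis unfolding 2 by (simp add: planar_op2_def graft_singleton)
    next
      case 3
      have "map coadd ?Us = (map (rcoadd \<circ> (the \<circ> Rep_ptree)) ?Us :: 'k planar_poly2 list)"
        by (auto simp: coadd_def empty_tree.rep_eq[symmetric] Rep_ptree_inject split: option.split)
      then show ?thesis
        using 3 by (auto simp: coadd_def[of "graft _"] Rep_graft simp del: map_eq_conv)
    qed
  qed
  ultimately show ?thesis by simp
qed

lemma planar_algebra_hom_coadd: "planar_algebra_hom (linear_ext coadd)"
  unfolding planar_algebra_hom_def
  by (auto simp: linear_linear_ext planar_op_def linear_ext_multilinear_ext
      planar_op2_coadd[symmetric])
    (simp add: planar_op2_def multilinear_ext_map_linear_ext)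

lemma planar_algebra_hom_unique:
  fixes f g :: "'k::field planar_poly \<Rightarrow> 'k planar_poly2"
  assumes f: "planar_algebra_hom f" and g: "planar_algebra_hom g"
    and dot: "f (mon dot_tree) = g (mon dot_tree)"
  shows "f = g"
proof -
  have *: "f (mon (Abs_ptree (Some t))) = g (mon (Abs_ptree (Some t)))" if "reduced t" for t
    using that
  proof (induction t)
    case (Node ts)
    show ?case
    proof (cases "ts = []")
      case True
      then show ?thesis using dot by (simp add: dot_tree_def)
    next
      case False
      let ?Ts = "map (\<lambda>t. Abs_ptree (Some t)) ts"
      have len: "length ?Ts \<ge> 2"
        using False Node.prems by (cases ts rule: remdups_adj.cases) auto
      have red: "\<forall>t\<in>set ts. Rep_ptree (Abs_ptree (Some t)) = Some t"
        using Node.prems by (auto simp: Abs_ptree_inverse)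
      have "empty_tree \<notin> set ?Ts"
        using red by (auto simp: empty_tree.rep_eq dest!: arg_cong[of empty_tree _ Rep_ptree])
      then have "Rep_ptree (graft ?Ts) = Some (Node ts)"
        using len red by (subst Rep_graft) (auto intro!: map_idI)
      then have "Abs_ptree (Some (Node ts)) = graft ?Ts"
        by (metis Rep_ptree_inverse)
      then have node: "mon (Abs_ptree (Some (Node ts))) = planar_op (map mon ?Ts)"
        by (simp only: planar_op_mon)
      have "map f (map mon ?Ts) = map g (map mon ?Ts)"
        using Node by auto
      moreover have "length (map mon ?Ts) \<ge> 2" using len by simp
      ultimately show ?thesis
        unfolding node using f g unfolding planar_algebra_hom_def by metis
    qed
  qed
  have mon: "f (mon T) = g (mon T)" for T
  proof (cases "Rep_ptree T")
    case None
    then have "T = empty_tree" by (metis empty_tree.rep_eq Rep_ptree_inject)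
    then show ?thesis using f g by (simp add: planar_algebra_hom_def)
  next
    case (Some t)
    have "reduced t" using Rep_ptree[of T] Some by simp
    moreover have "T = Abs_ptree (Some t)" by (metis Some Rep_ptree_inverse)
    ultimately show ?thesis using *[of t] by simp
  qed
  have lin: "Vector_Spaces.linear scale scale f" "Vector_Spaces.linear scale scale g"
    using f g by (auto simp: planar_algebra_hom_def)
  show ?thesis
  proof
    show "f p = g p" for p
      unfolding linear_eq_linear_ext[OF vector_space_scale lin(1), of p]
        linear_eq_linear_ext[OF vector_space_scale lin(2), of p] mon ..
  qed
qed

theorem ex1_planar_algebra_hom:
  "\<exists>!\<Delta> :: 'k::field planar_poly \<Rightarrow> 'k planar_poly2.
     planar_algebra_hom \<Delta> \<and>
     \<Delta> (mon dot_tree) = mon dot_tree \<otimes> mon empty_tree + mon empty_tree \<otimes> mon dot_tree"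
proof -
  have dot: "linear_ext coadd (mon dot_tree :: 'k planar_poly) =
      mon dot_tree \<otimes> mon empty_tree + mon empty_tree \<otimes> mon dot_tree"
    by (simp add: coadd_def dot_tree.rep_eq)
  show ?thesis
  proof (rule ex1I[of _ "linear_ext coadd"])
    fix f :: "'k planar_poly \<Rightarrow> 'k planar_poly2"
    assume "planar_algebra_hom f \<and>
      f (mon dot_tree) = mon dot_tree \<otimes> mon empty_tree + mon empty_tree \<otimes> mon dot_tree"
    then show "f = linear_ext coadd"
      using planar_algebra_hom_unique[OF _ planar_algebra_hom_coadd, of f] dot by simp
  qed (use dot planar_algebra_hom_coadd in auto)
qed

end

theory Submission
  imports Defs
begin

text \<open>A set of leaves of a grafting is a tuple of sets of leaves of the branches, and both
  contraction and complementation act branchwise. Hence the sum over all leaf sets \<open>I\<close> of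
  \<open>x\<^bsup>T|I\<^esup> \<otimes> x\<^bsup>T|(L(T) - I)\<^esup>\<close> satisfies the recursion that determines \<open>\<Delta>(x\<^bsup>T\<^esup>)\<close>; collecting
  equal summands yields the binomial coefficients.\<close>

text \<open>Addresses relative to child \<open>i\<close>; this is the set on which
  \<open>prune\<close> recurses.\<close>

definition branch :: "nat list set \<Rightarrow> nat \<Rightarrow> nat list set" where
  "branch I i = {p. i # p \<in> I}"

text \<open>Contraction on raw trees, so that structural induction on \<open>rtree\<close> applies.
  \<open>suppress\<close> always returns a reduced tree, hence the value is a genuine
  \<open>ptree\<close> for every \<open>t\<close>.\<close>

definition rcontraction :: "rtree \<Rightarrow> nat list set \<Rightarrow> ptree" where
  "rcontraction t I = Abs_ptree (if I = {} then None else Some (suppress (prune t I)))"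

lemma Rep_rcontraction:
  "Rep_ptree (rcontraction t I) = (if I = {} then None else Some (suppress (prune t I)))"
  unfolding rcontraction_def by (rule Abs_ptree_inverse) (simp add: reduced_suppress)

lemma rcontraction_empty [simp]: "rcontraction t {} = empty_tree"
  by (simp add: rcontraction_def empty_tree_def)

lemma contraction_eq_rcontraction:
  assumes "Rep_ptree T = Some t"
  shows "T \<downharpoonright> I = rcontraction t I"
  using assms by (simp add: Rep_ptree_inject[symmetric] contraction.rep_eq Rep_rcontraction)

lemma rleaves_Node_Nil: "rleaves (Node []) = {[]}"
proof -
  have "subtree_at (Node []) p = Some (Node []) \<longleftrightarrow> p = []" for p
    by (cases p) auto
  then show ?thesis by (auto simp: rleaves_def)
qed

lemma Nil_notin_rleaves: "ts \<noteq> [] \<Longrightarrow> [] \<notin> rleaves (Node ts)"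
  by (simp add: rleaves_def)

lemma Cons_in_rleaves: "i # p \<in> rleaves (Node ts) \<longleftrightarrow> i < length ts \<and> p \<in> rleaves (ts ! i)"
  by (simp add: rleaves_def)

lemma branch_Diff_rleaves:
  "i < length ts \<Longrightarrow> branch (rleaves (Node ts) - I) i = rleaves (ts ! i) - branch I i"
  by (auto simp: branch_def Cons_in_rleaves)

text \<open>Running over child positions instead of enumerated pairs puts pruning in the same
  indexed form as the list of contracted branches that is grafted below.\<close>

lemma prune_Node:
  "prune (Node ts) I =
     Node (map (\<lambda>i. prune (ts ! i) (branch I i)) (filter (\<lambda>i. branch I i \<noteq> {}) [0..<length ts]))"
proof -
  have "enumerate 0 ts = map (\<lambda>i. (i, ts ! i)) [0..<length ts]"
    by (auto intro: nth_equalityI simp: nth_enumerate_eq)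
  then show ?thesis
    by (simp add: filter_map o_def branch_def)
qed

text \<open>A branch that \<open>I\<close> misses contracts to the empty tree, which
  \<open>graft\<close> omits just as \<open>prune\<close> drops it. If a single branch survives,
  \<open>suppress\<close> deletes the root, as \<open>graft\<close> does for one nonempty
  argument.\<close>

lemma rcontraction_Node:
  assumes "ts \<noteq> []" and "I \<subseteq> rleaves (Node ts)"
  shows "rcontraction (Node ts) I =
    graft (map (\<lambda>i. rcontraction (ts ! i) (branch I i)) [0..<length ts])"
proof -
  let ?is = "filter (\<lambda>i. branch I i \<noteq> {}) [0..<length ts]"
  let ?us = "map (\<lambda>i. suppress (prune (ts ! i) (branch I i))) ?is"
  have "List.map_filter id (map Rep_ptree
      (map (\<lambda>i. rcontraction (ts ! i) (branch I i)) [0..<length ts])) = ?us"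
    by (simp add: map_filter_def filter_map o_def Rep_rcontraction if_distrib cong: filter_cong)
  then have graft: "Rep_ptree (graft (map (\<lambda>i. rcontraction (ts ! i) (branch I i)) [0..<length ts])) =
      (case ?us of [] \<Rightarrow> None | [t] \<Rightarrow> Some t | ts \<Rightarrow> Some (Node ts))"
    by (simp add: graft.rep_eq)
  \<comment> \<open>Contraction decides emptiness by \<open>I\<close>, grafting by the list of
    surviving branches. The tests agree because every address in \<open>I\<close> starts with the
    index of a child.\<close>
  have "?us = [] \<longleftrightarrow> I = {}"
  proof
    assume "?us = []"
    then have *: "\<forall>i<length ts. branch I i = {}" by (simp add: filter_empty_conv)
    have "p \<notin> I" for p
    proof (cases p)
      case Nil
      then show ?thesis using assms Nil_notin_rleaves by auto
    next
      case (Cons i q)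
      then show ?thesis using assms(2) * by (auto simp: branch_def Cons_in_rleaves)
    qed
    then show "I = {}" by auto
  qed (simp add: branch_def)
  moreover have "suppress (prune (Node ts) I) = (case ?us of [t] \<Rightarrow> t | ts' \<Rightarrow> Node ts')"
    by (simp only: prune_Node suppress.simps map_map o_def)
  ultimately have "Rep_ptree (rcontraction (Node ts) I) =
      (case ?us of [] \<Rightarrow> None | [t] \<Rightarrow> Some t | ts \<Rightarrow> Some (Node ts))"
    unfolding Rep_rcontraction by (auto split: list.split)
  with graft show ?thesis by (simp add: Rep_ptree_inject[symmetric])
qed

lemma mem_listset_iff:
  "xs \<in> listset As \<longleftrightarrow> length xs = length As \<and> (\<forall>i<length As. xs ! i \<in> As ! i)"
proof (induction As arbitrary: xs)
  case (Cons A As)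
  then show ?case
    by (cases xs) (auto simp: set_Cons_def nth_Cons split: nat.split)
qed simp

text \<open>The inverse puts the index \<open>i\<close> in front of the addresses in component
  \<open>i\<close> and takes the union.\<close>

lemma bij_betw_branches:
  assumes "ts \<noteq> []"
  shows "bij_betw (\<lambda>I. map (branch I) [0..<length ts])
    (Pow (rleaves (Node ts))) (listset (map (Pow \<circ> rleaves) ts))"
proof (rule bij_betw_byWitness[where f' = "\<lambda>Is. {i # p | i p. i < length ts \<and> p \<in> Is ! i}"])
  let ?join = "\<lambda>Is. {i # p | i p. i < length ts \<and> p \<in> Is ! i}"
  show "\<forall>I\<in>Pow (rleaves (Node ts)). ?join (map (branch I) [0..<length ts]) = I"
  proof
    fix I assume I: "I \<in> Pow (rleaves (Node ts))"
    \<comment> \<open>Joining never yields \<open>[]\<close>; since the root has children,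
      \<open>[]\<close> is not a leaf and so not in \<open>I\<close>.\<close>
    have "p \<in> ?join (map (branch I) [0..<length ts]) \<longleftrightarrow> p \<in> I" for p
      using I assms Nil_notin_rleaves[of ts]
      by (cases p) (auto simp: branch_def Cons_in_rleaves)
    then show "?join (map (branch I) [0..<length ts]) = I" by blast
  qed
  show "\<forall>Is\<in>listset (map (Pow \<circ> rleaves) ts). map (branch (?join Is)) [0..<length ts] = Is"
    by (auto intro!: nth_equalityI simp: mem_listset_iff branch_def)
  show "(\<lambda>I. map (branch I) [0..<length ts]) ` Pow (rleaves (Node ts)) \<subseteq>
      listset (map (Pow \<circ> rleaves) ts)"
    using Cons_in_rleaves by (fastforce simp: mem_listset_iff branch_def)
  show "?join ` listset (map (Pow \<circ> rleaves) ts) \<subseteq> Pow (rleaves (Node ts))"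
    by (fastforce simp: mem_listset_iff Cons_in_rleaves)
qed

text \<open>Distributivity: a multilinear map applied to sums of basis elements expands into one
  summand per choice of a term in each argument.\<close>

lemma multilinear_ext_sum_mon:
  "multilinear_ext F (map (\<lambda>a. \<Sum>b\<in>A a. mon (g a b)) as) =
     (\<Sum>bs\<in>listset (map A as). F (map2 g as bs))"
proof (induction as arbitrary: F)
  case (Cons a as)
  have "listset (map A (a # as)) = (\<lambda>(b, bs). b # bs) ` (A a \<times> listset (map A as))"
    by (auto simp: set_Cons_def)
  moreover have "inj_on (\<lambda>(b, bs). b # bs) (A a \<times> listset (map A as))"
    by (auto simp: inj_on_def)
  ultimately have "(\<Sum>bs\<in>listset (map A (a # as)). F (map2 g (a # as) bs)) =
      (\<Sum>b\<in>A a. \<Sum>bs\<in>listset (map A as). F (g a b # map2 g as bs))"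
    by (simp add: sum.reindex sum.cartesian_product case_prod_unfold)
  then show ?case
    by (simp add: linear_ext_sum Cons.IH)
qed simp

lemma rcoadd_eq_sum:
  "rcoadd t = (\<Sum>I\<in>Pow (rleaves t).
     mon (rcontraction t I, rcontraction t (rleaves t - I)) :: 'k::field planar_poly2)"
proof (induction t)
  case (Node ts)
  show ?case
  proof (cases "ts = []")
    case True
    have "rcontraction (Node []) {[]} = dot_tree"
      by (simp add: rcontraction_def dot_tree_def)
    \<comment> \<open>The single vertex has two leaf sets, which give the two summands of
      \<Delta>(x).\<close>
    moreover have "Pow {[]} = {{}, {[] :: nat list}}" by auto
    ultimately show ?thesis using True by (simp add: rleaves_Node_Nil add.commute)
  next
    case False
    let ?L = "rleaves (Node ts)"
    let ?g = "\<lambda>t I. (rcontraction t I, rcontraction t (rleaves t - I))"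
    let ?F = "\<lambda>Ps. mon (graft (map fst Ps), graft (map snd Ps)) :: 'k planar_poly2"
    have "map rcoadd ts = (map (\<lambda>t. \<Sum>I\<in>(Pow \<circ> rleaves) t. mon (?g t I)) ts :: 'k planar_poly2 list)"
      using Node.IH by simp
    then have "rcoadd (Node ts) =
        multilinear_ext ?F (map (\<lambda>t. \<Sum>I\<in>(Pow \<circ> rleaves) t. mon (?g t I)) ts)"
      using False by (simp add: planar_op2_def del: map_eq_conv)
    also have "\<dots> = (\<Sum>Is\<in>listset (map (Pow \<circ> rleaves) ts). ?F (map2 ?g ts Is))"
      by (rule multilinear_ext_sum_mon)
    \<comment> \<open>Choosing a leaf set in each branch amounts to choosing one leaf set of the
      whole tree.\<close>
    also have "\<dots> = (\<Sum>I\<in>Pow ?L. ?F (map2 ?g ts (map (branch I) [0..<length ts])))"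
      by (rule sum.reindex_bij_betw[OF bij_betw_branches[OF False], symmetric])
    also have "\<dots> = (\<Sum>I\<in>Pow ?L. mon (?g (Node ts) I))"
    proof (rule sum.cong[OF refl])
      fix I assume "I \<in> Pow ?L"
      then have I: "I \<subseteq> ?L" by simp
      have "map2 ?g ts (map (branch I) [0..<length ts]) =
          map (\<lambda>i. ?g (ts ! i) (branch I i)) [0..<length ts]"
        by (auto intro: nth_equalityI)
      \<comment> \<open>The second tensor factor contracts to the complement of \<open>I\<close>, so
        the branches of the complement must be the complements of the branches.\<close>
      moreover have "map (\<lambda>i. rcontraction (ts ! i) (branch (?L - I) i)) [0..<length ts] =
          map (\<lambda>i. rcontraction (ts ! i) (rleaves (ts ! i) - branch I i)) [0..<length ts]"
        by (simp add: branch_Diff_rleaves)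
      ultimately show "?F (map2 ?g ts (map (branch I) [0..<length ts])) = mon (?g (Node ts) I)"
        using rcontraction_Node[OF False I] rcontraction_Node[OF False Diff_subset, of I]
        by (simp add: o_def del: map_eq_conv)
    qed
    finally show ?thesis .
  qed
qed

lemma coadd_eq_sum: "coadd T = (\<Sum>I\<in>Pow (leaves T). mon (T \<downharpoonright> I, T \<downharpoonright> (leaves T - I)))"
proof (cases "Rep_ptree T")
  case None
  then have "T = empty_tree" by (metis empty_tree.rep_eq Rep_ptree_inject)
  moreover have "leaves empty_tree = {}" "empty_tree \<downharpoonright> {} = empty_tree"
    by (transfer, simp)+
  ultimately show ?thesis by simp
next
  case (Some t)
  then have "leaves T = rleaves t" by (simp add: leaves.rep_eq)
  with Some show ?thesis
    by (simp add: coadd_def rcoadd_eq_sum contraction_eq_rcontraction)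
qed

text \<open>The summands are grouped by the fibres of \<open>f\<close>; each coefficient is a fibre
  size.\<close>

lemma sum_mon_eq_Sum_any:
  assumes "finite A"
  shows "(\<Sum>a\<in>A. mon (f a)) =
    Sum_any (\<lambda>b. of_nat (card {a \<in> A. f a = b}) *\<^sub>s (mon b :: 'b \<Rightarrow>\<^sub>0 'k::field))"
proof -
  have const: "(\<Sum>a\<in>B. mon b) = of_nat (card B) *\<^sub>s (mon b :: 'b \<Rightarrow>\<^sub>0 'k)" if "finite B"
    for B :: "'a set" and b
    using that by (induction B) (simp_all add: scale.scale_left_distrib)
  have "(\<Sum>a\<in>A. mon (f a)) = (\<Sum>b\<in>f ` A. \<Sum>a\<in>{a \<in> A. f a = b}. mon (f a) :: 'b \<Rightarrow>\<^sub>0 'k)"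
    by (rule sum.image_gen[OF assms])
  also have "\<dots> = (\<Sum>b\<in>f ` A. of_nat (card {a \<in> A. f a = b}) *\<^sub>s mon b)"
    by (rule sum.cong) (use assms in \<open>simp_all add: const[symmetric]\<close>)
  also have "\<dots> = Sum_any (\<lambda>b. of_nat (card {a \<in> A. f a = b}) *\<^sub>s mon b)"
  \<comment> \<open>Only an inclusion of the support in the image of \<open>f\<close> is available:
    in positive characteristic a nonzero fibre size may vanish in the field.\<close>
  proof (rule Sum_any.expand_superset[symmetric])
    have "{a \<in> A. f a = b} = {}" if "b \<notin> f ` A" for b using that by auto
    then show "{b. of_nat (card {a \<in> A. f a = b}) *\<^sub>s (mon b :: 'b \<Rightarrow>\<^sub>0 'k) \<noteq> 0} \<subseteq> f ` A"
      by (metis (mono_tags, lifting) card.empty mem_Collect_eq of_nat_0 scale.scale_zero_left subsetI)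
  qed (use assms in simp)
  finally show ?thesis .
qed

theorem proposition5p1:
  fixes \<Delta> :: "'k::field planar_poly \<Rightarrow> 'k planar_poly2" and T :: ptree
  assumes "planar_algebra_hom \<Delta>"
    and "\<Delta> (mon dot_tree) = mon dot_tree \<otimes> mon empty_tree + mon empty_tree \<otimes> mon dot_tree"
  shows "\<Delta> (mon T) =
    Sum_any (\<lambda>(S, V). of_nat (planar_binomial T S V) *\<^sub>s (mon S \<otimes> mon V))"
proof -
  have "linear_ext coadd (mon dot_tree :: 'k planar_poly) =
      mon dot_tree \<otimes> mon empty_tree + mon empty_tree \<otimes> mon dot_tree"
    by (simp add: coadd_def dot_tree.rep_eq)
  \<comment> \<open>Both homomorphisms take the same value at x, so uniqueness identifies
    them.\<close>
  then have "\<Delta> = linear_ext coadd"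
    using planar_algebra_hom_unique[OF assms(1) planar_algebra_hom_coadd] assms(2) by simp
  then have "\<Delta> (mon T) = (\<Sum>I\<in>Pow (leaves T). mon (T \<downharpoonright> I, T \<downharpoonright> (leaves T - I)))"
    by (simp add: coadd_eq_sum)
  also have "\<dots> = Sum_any (\<lambda>b. of_nat (card {I \<in> Pow (leaves T).
      (T \<downharpoonright> I, T \<downharpoonright> (leaves T - I)) = b}) *\<^sub>s mon b)"
    by (rule sum_mon_eq_Sum_any) (simp add: finite_leaves)
  \<comment> \<open>The fibre over \<open>(S, V)\<close> is exactly the set counted by the binomial
    coefficient.\<close>
  also have "\<dots> = Sum_any (\<lambda>(S, V). of_nat (planar_binomial T S V) *\<^sub>s (mon S \<otimes> mon V))"
    by (rule arg_cong[of _ _ Sum_any]) (auto simp: planar_binomial_def)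
  finally show ?thesis .
qed

end
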